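(* For every $m\ge 2$, the values $b(w,j)$, $w\in\{0,1,2\}^m$, $j\in\{0,1,2\}$, constructed by the recursive algorithm described in the context satisfy: (a) symmetry under permutations: $b(\sigma(w),\sigma(j))=b(w,j)$ for every permutation $\sigma$ of $\{0,1,2\}$, where $\sigma(w)=(\sigma(w_1),\dots,\sigma(w_m))$; (b) $b(w,0)+b(w,1)+b(w,2)=3$ for all words $w$ of length $m$; (c) $b(w'i,j)+b(w'j,i)=0$ for all words $w'$ of length $m-1$ and all $i\ne j$ in $\{0,1,2\}$, where $w'i$ is the word of length $m$ consisting of $w'$ followed by the letter $i$; (d) $b(0^m,0)=3^m$, where $0^m=(0,0,\dots,0)$.
   Context: Words are finite sequences of letters in $\{0,1,2\}$, and $|w|$ is the length of $w$. Permutations of $\{0,1,2\}$ act on words letter by letter. The numbers $b_n$. For an integer $n\ge 0$ with base-2 expansion $n=\sum_{k=1}^N 2^{J_k}$, $0\le J_1<J_2<\dots<J_N$, set $b_n=3\sum_{k=1}^N 3^{J_k}$ (so $b_0=0$). The algorithm. For $m\ge 2$ the level-$m$ values $b(w,j)$, $|w|=m$, $j\in\{0,1,2\}$, are constructed recursively in $m$. First let $w=0\tilde w$ have first letter $0$, with $|\tilde w|=m-1$. (1) If $\tilde w$ consists of letters $0$ and $1$ only, read $w$ as a base-2 number (first letter most significant), put $n=2^{m-1}-w$, and set $$b(0\tilde w,0)=b_n,\qquad b(0\tilde w,1)=-b_{n-1},\qquad b(0\tilde w,2)=3-b_n+b_{n-1}.$$ If $\tilde w$ consists of letters $0$ and $2$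 only and contains a $2$, define $b(0\tilde w,j)=b(0\tau(\tilde w),\tau(j))$, where $\tau$ is the transposition exchanging $1$ and $2$, and the right side is given by the preceding rule. For $m=2$ this covers all words with first letter $0$. For $m\ge3$, if both letters $1$ and $2$ occur in $\tilde w$, the values are obtained from those of level $m-1$: (2) if $\tilde w=1w'$, set $b(01w',j)=b(0w',j)$, and if $\tilde w=2w'$, set $b(02w',j)=b(0w',j)$, for $j=0,1,2$; (3) if $\tilde w=0w'$ (so both $1$ and $2$ occur in $w'$), set $b(00w',j)=b(0w',j)$ for $j=0,1,2$. Here $0w'$ is a word of length $m-1$ and the right sides are level-$(m-1)$ values. Finally, if the first letter of $w$ is $w_1\neq0$, set $b(w,j)=b(\rho(w),\rho(j))$, where $\rho$ is the transposition exchanging $0$ and $w_1$. *)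

theory Defs
  imports "HOL-Combinatorics.Permutations"
begin

text \<open>
  Letters are the natural numbers 0, 1, 2; words are lists of letters.
\<close>

definition words :: "nat \<Rightarrow> nat list set" where
  "words m = {w. length w = m \<and> set w \<subseteq> {0, 1, 2}}"

text \<open>
  The set of exponents in the binary expansion of \<open>n\<close> is the (finite) set of positions of the
  nonzero bits of \<open>n\<close>.
\<close>

definition bnum :: "nat \<Rightarrow> int" where
  "bnum n = 3 * (\<Sum>J | bit n J. 3 ^ J)"

text \<open>
  \<^const>\<open>horner_sum\<close> takes the least significant digit first, hence the reversal.
\<close>

definition base2 :: "nat list \<Rightarrow> nat" where
  "base2 w = horner_sum id 2 (rev w)"

text \<open>
  Used only for words \<open>w\<close> over 0, 1 with first letter 0; then \<open>base2 w < 2 ^ (length w - 1)\<close>, so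
  that \<open>n \<ge> 1\<close> and the subtractions on natural numbers do not truncate.
\<close>

definition initial_value :: "nat list \<Rightarrow> nat \<Rightarrow> int" where
  "initial_value w j =
    (let n = 2 ^ (length w - 1) - base2 w in
      if j = 0 then bnum n
      else if j = 1 then - bnum (n - 1)
      else 3 - bnum n + bnum (n - 1))"

text \<open>
  In the last branch both 1 and 2 occur in \<open>u\<close>. The rules for \<open>u = 1w'\<close>, \<open>u = 2w'\<close> and \<open>u = 0w'\<close>
  all prescribe the value at \<open>0w'\<close>, i.e. they delete the second letter of the word. Only words over
  0, 1, 2 of length at least 2 are meaningful, and the recursion never leaves them: for \<open>u\<close> of
  length 1 one of the two preceding branches applies.
\<close>

function bval :: "nat list \<Rightarrow> nat \<Rightarrow> int" where
  "bval [] j = 0"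
| "bval (x # u) j =
    (if x \<noteq> 0 then bval (map (transpose 0 x) (x # u)) (transpose 0 x j)
     else if set u \<subseteq> {0, 1} then initial_value (0 # u) j
     else if set u \<subseteq> {0, 2} then bval (0 # map (transpose 1 2) u) (transpose 1 2 j)
     else bval (0 # tl u) j)"
  by pat_completeness auto

lemma length_tl_less: "length (tl u) < length u \<longleftrightarrow> u \<noteq> []"
  by (cases u) auto

termination
  by (relation "measures [\<lambda>(w, j). length w, \<lambda>(w, j). if hd w = 0 then 0 else 1,
        \<lambda>(w, j). if set (tl w) \<subseteq> {0, 1} then 0 else 1]")
     (auto simp: transpose_def length_tl_less simp del: length_tl)

end

theory Submission
  imports Defs
begin

text \<open>
  Everything is reduced to words with first letter 0, where two observations about a word \<open>0u\<close>
  suffice.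

  The first is that the values are invariant under exchanging 1 and 2 (\<open>bval_swap12\<close>). For words
  over 0 and 1 that contain a 1 this is the way the values over 0 and 2 are defined, and deleting
  the second letter commutes with the exchange; the only real case is \<open>0\<^sup>m\<close>, where it is the
  identity \<open>2 b\<^sub>N = 3\<^sup>m - 3\<close> for \<open>N = 2\<^sup>m\<^sup>-\<^sup>1 - 1\<close>, a geometric sum. Since a permutation is determined
  by the image of 0 up to the exchange of 1 and 2, full symmetry (a) follows from it.

  The second is that the deletion rule holds more often than it is prescribed: if \<open>u\<close> contains a 1,
  then deleting its first letter does not change the value at 2, even if \<open>u\<close> contains no 2
  (\<open>bval_two_delete\<close>). For binary \<open>u\<close> the value at 2 is \<open>3 - (b\<^sub>n - b\<^sub>n\<^sub>-\<^sub>1)\<close>, and the difference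
  depends only on \<open>n\<close> up to its lowest nonzero bit, whereas the first letter of \<open>u\<close> affects at most
  a higher bit of \<open>n\<close>.

  For the antisymmetry (c), consider \<open>b(0ui,j) + b(0uj,i)\<close>. If \<open>{i,j} = {1,2}\<close>, both words may be
  shortened until \<open>u\<close> is empty, and \<open>b(01,2) = b(02,1) = 0\<close>. If \<open>{i,j} = {0,2}\<close>, both words may be
  shortened until \<open>u\<close> contains no 1, and exchanging 1 and 2 leads to \<open>{i,j} = {0,1}\<close> and binary \<open>u\<close>.
  There \<open>u0\<close> and \<open>u1\<close> are consecutive binary numbers, so the two values are \<open>-b\<^sub>n\<^sub>-\<^sub>1\<close> and \<open>b\<^sub>n\<^sub>-\<^sub>1\<close>
  for the same \<open>n\<close>. Exchanging 1 and 2 once more gives \<open>{i,j} = {0,1}\<close> for all \<open>u\<close>.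

  Both the exchange and the deletion preserve the sum of the three values, which gives (b), and (d)
  is \<open>b\<^sub>n = 3\<^sup>m\<close> for \<open>n = 2\<^sup>m\<^sup>-\<^sup>1\<close>.
\<close>

declare bval.simps [simp del]
(* The letter 1 has to stay a numeral, or else simplification rules about transpose 1 2 never match. *)
declare One_nat_def [simp del]

section \<open>The numbers \<open>b\<^sub>n\<close>\<close>

lemma finite_bits: "finite {J. bit (n::nat) J}"
proof (rule finite_subset)
  show "{J. bit n J} \<subseteq> {..<n}"
  proof
    fix J assume "J \<in> {J. bit n J}"
    then have J: "bit n J" by simp
    show "J \<in> {..<n}"
    proof (rule ccontr)
      assume "J \<notin> {..<n}"
      then have "n < 2 ^ J" using less_exp[of J] by (intro le_less_trans[of n J]) simp_all
      with J show False by (simp add: bit_iff_odd)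
    qed
  qed
qed simp

lemma bnum_0 [simp]: "bnum 0 = 0"
  by (simp add: bnum_def)

lemma bnum_add_top_bit:
  assumes "n < 2 ^ k"
  shows "bnum (n + 2 ^ k) = bnum n + 3 ^ Suc k"
proof -
  have low: "\<not> bit n J" if "J \<ge> k" for J
  proof -
    have "n < 2 ^ J"
      using assms power_increasing[OF that, of "2::nat"] by linarith
    then show ?thesis by (simp add: bit_iff_odd)
  qed
  have "n + 2 ^ k = or n (2 ^ k)"
    by (rule disjunctive_add_eq_or) (intro bit_eqI, auto simp: bit_simps low)
  then have "{J. bit (n + 2 ^ k) J} = insert k {J. bit n J}"
    by (auto simp: bit_simps)
  then show ?thesis
    using low[of k] finite_bits[of n] by (simp add: bnum_def)
qed

lemma bnum_power2: "bnum (2 ^ k) = 3 ^ Suc k"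
  using bnum_add_top_bit[of 0 k] by simp

lemma bnum_1 [simp]: "bnum 1 = 3" "bnum (Suc 0) = 3"
  using bnum_power2[of 0] by (simp_all add: One_nat_def)

lemma bnum_power2_minus_1: "2 * bnum (2 ^ k - 1) = 3 ^ Suc k - 3"
proof (induction k)
  case (Suc k)
  have "(2::nat) ^ Suc k - 1 = (2 ^ k - 1) + 2 ^ k" by simp
  then show ?case using Suc bnum_add_top_bit[of "2 ^ k - 1" k] by simp
qed simp

section \<open>Binary words\<close>

lemma base2_Nil [simp]: "base2 [] = 0"
  by (simp add: base2_def)

lemma base2_Cons: "base2 (x # u) = x * 2 ^ length u + base2 u"
  by (simp add: base2_def horner_sum_append)

lemma base2_snoc: "base2 (u @ [x]) = 2 * base2 u + x"
  by (simp add: base2_def)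

lemma base2_less: "set u \<subseteq> {0, 1} \<Longrightarrow> base2 u < 2 ^ length u"
  by (induction u) (auto simp: base2_Cons)

lemma base2_eq_0_iff: "base2 u = 0 \<longleftrightarrow> set u \<subseteq> {0}"
  by (induction u) (auto simp: base2_Cons)

section \<open>Evaluation of words with first letter 0\<close>

lemma bval_binary:
  "set u \<subseteq> {0, 1} \<Longrightarrow> bval (0 # u) j = initial_value (0 # u) j"
  by (simp add: bval.simps(2))

lemma bval_zeros_one_eq_two:
  assumes "set u \<subseteq> {0}"
  shows "bval (0 # u) 1 = bval (0 # u) 2"
proof -
  have "set u \<subseteq> {0, 1}" "base2 (0 # u) = 0"
    using assms base2_eq_0_iff[of u] by (auto simp: base2_Cons)
  then show ?thesis
    using bnum_power2_minus_1[of "length u"] bnum_power2[of "length u"]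
    by (simp add: bval_binary initial_value_def)
qed

lemma bval_delete:
  "1 \<in> set u \<Longrightarrow> 2 \<in> set u \<Longrightarrow> bval (0 # u) j = bval (0 # tl u) j"
  by (subst bval.simps(2)) auto

abbreviation swap12 :: "nat \<Rightarrow> nat" where
  "swap12 \<equiv> transpose 1 2"

lemma swap12_simps [simp]:
  "swap12 0 = 0" "swap12 1 = 2" "swap12 2 = 1"
  by (auto simp: transpose_def)

lemma map_swap12_swap12 [simp]: "map swap12 (map swap12 u) = u"
  by (simp add: comp_def map_idI)

lemma in_set_map_swap12:
  "1 \<in> set (map swap12 u) \<longleftrightarrow> 2 \<in> set u"
  "2 \<in> set (map swap12 u) \<longleftrightarrow> 1 \<in> set u"
  by (force simp: transpose_def split: if_splits)+

lemma set_map_swap12_subset: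
  "set u \<subseteq> {0, 1, 2} \<Longrightarrow> set (map swap12 u) \<subseteq> {0, 1, 2}"
  by (auto simp: transpose_def)

lemma bval_swap12_rule:
  assumes "set u \<subseteq> {0, 2}"
    and "2 \<in> set u"
  shows "bval (0 # u) j = bval (0 # map swap12 u) (swap12 j)"
  using assms by (subst bval.simps(2)) auto

text \<open>
  For \<open>u\<close> consisting of zeros the exchange fixes the word, so the values at 1 and 2 have to agree.
\<close>

lemma bval_swap12:
  assumes "set u \<subseteq> {0, 1, 2}"
    and "j \<in> {0, 1, 2}"
  shows "bval (0 # map swap12 u) (swap12 j) = bval (0 # u) j"
  using assms(1)
proof (induction u)
  case Nil
  then show ?case using assms(2) bval_zeros_one_eq_two[of "[]"] by auto
next
  case (Cons x v)
  define u where "u = x # v"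
  have u: "set u \<subseteq> {0, 1, 2}" using Cons.prems by (simp add: u_def)
  consider "1 \<notin> set u" "2 \<notin> set u" | "1 \<in> set u" "2 \<notin> set u" | "1 \<notin> set u" "2 \<in> set u"
    | "1 \<in> set u" "2 \<in> set u" by blast
  then have "bval (0 # map swap12 u) (swap12 j) = bval (0 # u) j"
  proof cases
    case 1
    then have zeros: "set u \<subseteq> {0}" using u by auto
    then have "map swap12 u = u" by (intro map_idI) auto
    then show ?thesis using bval_zeros_one_eq_two[OF zeros] assms(2) by auto
  next
    case 2
    then have "set u \<subseteq> {0, 1}" using u by auto
    then have "set (map swap12 u) \<subseteq> {0, 2}" by auto
    moreover have "2 \<in> set (map swap12 u)" using 2 in_set_map_swap12 by blast
    ultimately show ?thesis
      using bval_swap12_rule[of "map swap12 u" "swap12 j"] by (simp only: map_swap12_swap12 transpose_involutory)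
  next
    case 3
    then have "set u \<subseteq> {0, 2}" using u by auto
    then show ?thesis using bval_swap12_rule[of u j] 3 by simp
  next
    case 4
    then have "bval (0 # map swap12 u) (swap12 j) = bval (0 # tl (map swap12 u)) (swap12 j)"
      using in_set_map_swap12[of u] by (intro bval_delete) blast+
    also have "\<dots> = bval (0 # v) j" using Cons by (simp add: u_def)
    also have "\<dots> = bval (0 # u) j" using 4 bval_delete[of u j] by (simp add: u_def)
    finally show ?thesis .
  qed
  then show ?case by (simp only: u_def)
qed

section \<open>Symmetry under all permutations\<close>

text \<open>
  This covers first letter 0 as well, since then the transposition is the identity.
\<close>

lemma bval_normalize:
  "bval (x # u) j = bval (map (transpose 0 x) (x # u)) (transpose 0 x j)"
proof (cases "x = 0")
  case False
  then show ?thesis by (subst bval.simps(2)) simp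
qed simp

lemma permutes_image_subset: "p permutes A \<Longrightarrow> B \<subseteq> A \<Longrightarrow> p ` B \<subseteq> A"
  using image_mono[of B A p] by (simp add: permutes_image)

lemma permutes_fixing_0:
  assumes "p permutes {0, 1, 2 :: nat}"
    and "p 0 = 0"
  shows "p = id \<or> p = swap12"
proof -
  have "p permutes {1, 2}"
    using permutes_superset[OF assms(1), of "{1, 2}"] assms(2) by auto
  then show ?thesis by (simp add: permutes_doubleton_iff)
qed

text \<open>
  Moving the first letters of \<open>w\<close> and \<open>\<sigma>(w)\<close> to 0 turns \<open>\<sigma>\<close> into a permutation that fixes 0, that is,
  into the identity or the exchange of 1 and 2.
\<close>

lemma bval_permute:
  assumes p: "p permutes {0, 1, 2}"
    and w: "set w \<subseteq> {0, 1, 2}"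
    and j: "j \<in> {0, 1, 2}"
  shows "bval (map p w) (p j) = bval w j"
proof (cases w)
  case Nil
  then show ?thesis by (simp add: bval.simps(1))
next
  case (Cons x u)
  define r where "r = transpose 0 x"
  define s where "s = transpose 0 (p x)"
  define q where "q = s \<circ> p \<circ> r"
  have x: "x \<in> {0, 1, 2}" using w Cons by simp
  have r: "r permutes {0, 1, 2}"
    unfolding r_def using x by (intro permutes_swap_id) auto
  have s: "s permutes {0, 1, 2}"
    unfolding s_def using permutes_in_image[OF p, of x] x by (intro permutes_swap_id) auto
  have q: "q permutes {0, 1, 2}"
    unfolding q_def by (intro permutes_compose r p s)
  have q0: "q 0 = 0" by (simp add: q_def r_def s_def)
  have qr: "q (r k) = s (p k)" for k
    by (simp add: q_def r_def)
  have in_r: "r k \<in> {0, 1, 2}" if "k \<in> {0, 1, 2}" for k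
    using permutes_in_image[OF r, of k] that by blast
  then have ru: "set (map r u) \<subseteq> {0, 1, 2}"
    using permutes_image_subset[OF r, of "set u"] w Cons by simp
  have "bval (map p w) (p j) = bval (map s (map p w)) (s (p j))"
    using bval_normalize[of "p x" "map p u" "p j"] by (simp add: Cons s_def)
  also have "\<dots> = bval (map q (map r w)) (q (r j))"
    by (simp add: qr comp_def)
  also have "\<dots> = bval (map r w) (r j)"
  proof -
    have "map r w = 0 # map r u" by (simp add: Cons r_def)
    then show ?thesis
      using permutes_fixing_0[OF q q0] bval_swap12[OF ru in_r[OF j]] by auto
  qed
  also have "\<dots> = bval w j"
    using bval_normalize[of x u j] by (simp add: Cons r_def)
  finally show ?thesis .
qed

text \<open>
  A property of words and letters that is invariant under permutations only needs to be checked for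
  words with first letter 0.
\<close>

lemma permutation_to_leading_zero:
  assumes "set w \<subseteq> {0, 1, 2}"
    and "w \<noteq> []"
  obtains r u where "r permutes {0, 1, 2 :: nat}" "map r w = 0 # u" "set u \<subseteq> {0, 1, 2}"
proof -
  obtain x v where w: "w = x # v" using assms(2) by (cases w) auto
  define r where "r = transpose 0 x"
  have r: "r permutes {0, 1, 2}"
    unfolding r_def using assms(1) w by (intro permutes_swap_id) auto
  have "map r w = 0 # map r v" by (simp add: w r_def)
  moreover have "set (map r v) \<subseteq> {0, 1, 2}"
    using permutes_image_subset[OF r, of "set v"] assms(1) w by simp
  ultimately show ?thesis by (rule that[OF r])
qed

section \<open>The sum of the three values\<close>

lemma bval_sum_leading_zero:
  "set u \<subseteq> {0, 1, 2} \<Longrightarrow> bval (0 # u) 0 + bval (0 # u) 1 + bval (0 # u) 2 = 3"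
proof (induction u)
  case Nil
  then show ?case by (simp add: bval_binary initial_value_def Let_def)
next
  case (Cons x v)
  define u where "u = x # v"
  have u: "set u \<subseteq> {0, 1, 2}" using Cons.prems by (simp add: u_def)
  have binary: "bval (0 # y) 0 + bval (0 # y) 1 + bval (0 # y) 2 = 3" if "set y \<subseteq> {0, 1}" for y
    using that by (simp add: bval_binary initial_value_def Let_def)
  consider "2 \<notin> set u" | "1 \<notin> set u" | "1 \<in> set u" "2 \<in> set u" by blast
  then have "bval (0 # u) 0 + bval (0 # u) 1 + bval (0 # u) 2 = 3"
  proof cases
    case 1
    then show ?thesis using u by (intro binary) auto
  next
    case 2
    then have "set (map swap12 u) \<subseteq> {0, 1}" using u by (auto simp: transpose_def)
    from binary[OF this] show ?thesis
      using bval_swap12[OF u, of 0] bval_swap12[OF u, of 1] bval_swap12[OF u, of 2] by simp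
  next
    case 3
    then show ?thesis using Cons bval_delete[of u] by (simp add: u_def)
  qed
  then show ?case by (simp only: u_def)
qed

lemma bval_sum:
  assumes "set w \<subseteq> {0, 1, 2}"
    and "w \<noteq> []"
  shows "bval w 0 + bval w 1 + bval w 2 = 3"
proof -
  obtain r u where r: "r permutes {0, 1, 2 :: nat}" and u: "map r w = 0 # u" "set u \<subseteq> {0, 1, 2}"
    using permutation_to_leading_zero[OF assms] by blast
  have "(\<Sum>j\<in>{0, 1, 2}. bval w j) = (\<Sum>j\<in>{0, 1, 2}. bval (map r w) (r j))"
    using bval_permute[OF r assms(1)] by (intro sum.cong) auto
  also have "\<dots> = (\<Sum>j\<in>{0, 1, 2}. bval (map r w) j)"
    using sum.permute[OF r, of "bval (map r w)"] by (simp add: comp_def)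
  also have "\<dots> = 3"
    using bval_sum_leading_zero[OF u(2)] by (simp add: u(1))
  finally show ?thesis by simp
qed

section \<open>Antisymmetry in the last letter\<close>

text \<open>
  If the letter 2 occurs this is the deletion rule. Otherwise let \<open>n\<close> and \<open>n'\<close> be the numbers assigned
  to \<open>0u\<close> and \<open>0v\<close>, where \<open>v\<close> is \<open>u\<close> without its first letter \<open>x\<close>. For \<open>x = 1\<close> they agree. For \<open>x = 0\<close>
  they differ by a power of 2; as \<open>v\<close> contains a 1, this power is a new top bit of \<open>n\<close> and of \<open>n - 1\<close>,
  so it drops out of \<open>b\<^sub>n - b\<^sub>n\<^sub>-\<^sub>1\<close>.
\<close>

lemma bval_two_delete:
  assumes "set u \<subseteq> {0, 1, 2}"
    and "1 \<in> set u"
  shows "bval (0 # u) 2 = bval (0 # tl u) 2"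
proof (cases "2 \<in> set u")
  case True
  then show ?thesis using assms by (intro bval_delete)
next
  case False
  obtain x v where u: "u = x # v" using assms(2) by (cases u) auto
  have bin: "set u \<subseteq> {0, 1}" using assms False by auto
  then have v: "set v \<subseteq> {0, 1}" and x: "x = 0 \<or> x = 1" by (auto simp: u)
  define n where "n = 2 ^ length v - base2 v"
  have n: "n \<ge> 1" "n \<le> 2 ^ length v"
    using base2_less[OF v] by (auto simp: n_def)
  have bv: "bval (0 # v) 2 = 3 - bnum n + bnum (n - 1)"
    using v by (simp add: bval_binary initial_value_def base2_Cons n_def)
  show ?thesis
  proof (cases "x = 1")
    case True
    then have "2 ^ length u - base2 (0 # u) = n"
      by (simp add: u n_def base2_Cons)
    then show ?thesis using bin bv by (simp add: bval_binary initial_value_def u)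
  next
    case False
    with x assms(2) have x0: "x = 0" and "1 \<in> set v" by (auto simp: u)
    then have "base2 v \<noteq> 0" by (auto simp: base2_eq_0_iff)
    then have less: "n < 2 ^ length v" by (simp add: n_def)
    have eq: "2 ^ length u - base2 (0 # u) = n + 2 ^ length v"
      using base2_less[OF v] x0 by (simp add: u n_def base2_Cons)
    have pred: "n + 2 ^ length v - 1 = (n - 1) + 2 ^ length v" using n by simp
    have "n - 1 < 2 ^ length v" using less by simp
    then have "bnum (n + 2 ^ length v) - bnum (n + 2 ^ length v - 1) = bnum n - bnum (n - 1)"
      unfolding pred using bnum_add_top_bit[OF less] bnum_add_top_bit[of "n - 1"] by simp
    moreover have "bval (0 # u) 2 = 3 - bnum (n + 2 ^ length v) + bnum (n + 2 ^ length v - 1)"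
      using bin eq by (simp add: bval_binary initial_value_def Let_def)
    ultimately show ?thesis using bv by (simp add: u)
  qed
qed

text \<open>
  The last letter 1 permits deletion down to the word 01.
\<close>

lemma bval_last_one_at_two:
  "set u \<subseteq> {0, 1, 2} \<Longrightarrow> bval (0 # u @ [1]) 2 = 0"
proof (induction u)
  case Nil
  then show ?case by (simp add: bval_binary initial_value_def Let_def base2_Cons)
next
  case (Cons x v)
  then show ?case using bval_two_delete[of "x # v @ [1]"] by simp
qed

text \<open>
  If \<open>n\<close> belongs to \<open>0u0\<close>, then \<open>n - 1\<close> belongs to \<open>0u1\<close>.
\<close>

lemma antisym_binary_0_1:
  assumes "set u \<subseteq> {0, 1}"
  shows "bval (0 # u @ [0]) 1 + bval (0 # u @ [1]) 0 = 0"
proof -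
  have "base2 (0 # u @ [1]) = base2 (0 # u @ [0]) + 1"
    by (simp add: base2_Cons base2_snoc)
  then show ?thesis
    using assms by (simp add: bval_binary initial_value_def)
qed

text \<open>
  As long as \<open>u\<close> contains a 1, its first letter can be deleted from both words: from \<open>0u0\<close> because
  only the value at 2 is concerned, from \<open>0u2\<close> because both 1 and 2 occur. Without a 1, the word \<open>u\<close>
  becomes binary by exchanging 1 and 2.
\<close>

lemma antisym_0_2:
  "set u \<subseteq> {0, 1, 2} \<Longrightarrow> bval (0 # u @ [0]) 2 + bval (0 # u @ [2]) 0 = 0"
proof (induction u)
  case Nil
  then show ?case
    using antisym_binary_0_1[of "[]"] bval_swap12[of "[0]" 1] bval_swap12[of "[1]" 0] by simp
next
  case (Cons x v)
  show ?case
  proof (cases "1 \<in> set (x # v)")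
    case True
    then have "bval (0 # x # v @ [0]) 2 = bval (0 # v @ [0]) 2"
      using Cons.prems bval_two_delete[of "x # v @ [0]"] by simp
    moreover have "bval (0 # x # v @ [2]) 0 = bval (0 # v @ [2]) 0"
      using True bval_delete[of "x # v @ [2]" 0] by simp
    ultimately show ?thesis using Cons by simp
  next
    case False
    define u where "u = x # v"
    have u: "set u \<subseteq> {0, 1, 2}" using Cons.prems by (simp add: u_def)
    have "set (map swap12 u) \<subseteq> {0, 1}" using u False by (auto simp: u_def transpose_def)
    from antisym_binary_0_1[OF this] have "bval (0 # u @ [0]) 2 + bval (0 # u @ [2]) 0 = 0"
      using bval_swap12[of "u @ [0]" 2] bval_swap12[of "u @ [2]" 0] u by simp
    then show ?thesis by (simp add: u_def)
  qed
qed

lemma antisym_leading_zero: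
  assumes u: "set u \<subseteq> {0, 1, 2}"
    and ij: "i \<in> {0, 1, 2}" "j \<in> {0, 1, 2}" "i \<noteq> j"
  shows "bval (0 # u @ [i]) j + bval (0 # u @ [j]) i = 0"
proof -
  have u': "set (map swap12 u) \<subseteq> {0, 1, 2}" by (rule set_map_swap12_subset[OF u])
  have "bval (0 # u @ [0]) 1 + bval (0 # u @ [1]) 0 = 0"
    using antisym_0_2[OF u'] bval_swap12[of "u @ [0]" 1] bval_swap12[of "u @ [1]" 0] u by simp
  moreover have "bval (0 # u @ [1]) 2 + bval (0 # u @ [2]) 1 = 0"
    using bval_last_one_at_two[OF u] bval_last_one_at_two[OF u'] bval_swap12[of "u @ [2]" 1] u by simp
  ultimately show ?thesis
    using antisym_0_2[OF u] ij by auto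
qed

lemma antisym_last_letter:
  assumes w: "set w \<subseteq> {0, 1, 2}" "w \<noteq> []"
    and ij: "i \<in> {0, 1, 2}" "j \<in> {0, 1, 2}" "i \<noteq> j"
  shows "bval (w @ [i]) j + bval (w @ [j]) i = 0"
proof -
  obtain r u where r: "r permutes {0, 1, 2 :: nat}" and u: "map r w = 0 # u" "set u \<subseteq> {0, 1, 2}"
    using permutation_to_leading_zero[OF w] by blast
  have rij: "r i \<in> {0, 1, 2}" "r j \<in> {0, 1, 2}" "r i \<noteq> r j"
    using ij inj_eq[OF permutes_inj[OF r]] by (simp_all only: permutes_in_image[OF r] simp_thms)
  have "bval (w @ [k]) l = bval (0 # u @ [r k]) (r l)" if "k \<in> {0, 1, 2}" "l \<in> {0, 1, 2}" for k l
    using bval_permute[OF r, of "w @ [k]" l] w that by (simp add: u(1))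
  then show ?thesis
    using antisym_leading_zero[OF u(2) rij] ij by simp
qed

section \<open>The properties of the values\<close>

lemma bval_zeros: "bval (0 # replicate k 0) 0 = 3 ^ Suc k"
proof -
  have "set (replicate k (0::nat)) \<subseteq> {0}" "set (replicate k (0::nat)) \<subseteq> {0, 1}" by auto
  then show ?thesis
    using base2_eq_0_iff[of "replicate k 0"] bnum_power2[of k] bval_binary[of "replicate k 0" 0]
    by (simp add: initial_value_def base2_Cons)
qed

theorem theorem2p4:
  fixes m :: nat
  assumes "m \<ge> 2"
  shows "(\<forall>\<sigma> w j. \<sigma> permutes {0, 1, 2} \<longrightarrow> w \<in> words m \<longrightarrow> j \<in> {0, 1, 2} \<longrightarrow>
            bval (map \<sigma> w) (\<sigma> j) = bval w j) \<and>
         (\<forall>w \<in> words m. bval w 0 + bval w 1 + bval w 2 = 3) \<and>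
         (\<forall>w' \<in> words (m - 1). \<forall>i \<in> {0, 1, 2}. \<forall>j \<in> {0, 1, 2}. i \<noteq> j \<longrightarrow>
            bval (w' @ [i]) j + bval (w' @ [j]) i = 0) \<and>
         bval (replicate m 0) 0 = 3 ^ m"
proof (intro conjI allI impI ballI)
  fix \<sigma> :: "nat \<Rightarrow> nat" and w and j :: nat
  assume "\<sigma> permutes {0, 1, 2}" "w \<in> words m" "j \<in> {0, 1, 2}"
  then show "bval (map \<sigma> w) (\<sigma> j) = bval w j"
    by (intro bval_permute) (auto simp: words_def)
next
  fix w assume "w \<in> words m"
  then show "bval w 0 + bval w 1 + bval w 2 = 3"
    using assms by (intro bval_sum) (auto simp: words_def)
next
  fix w' and i j :: nat
  assume "w' \<in> words (m - 1)" "i \<in> {0, 1, 2}" "j \<in> {0, 1, 2}" "i \<noteq> j"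
  then show "bval (w' @ [i]) j + bval (w' @ [j]) i = 0"
    using assms by (intro antisym_last_letter) (auto simp: words_def)
next
  obtain k where "m = Suc k" using assms by (cases m) auto
  then show "bval (replicate m 0) 0 = 3 ^ m" using bval_zeros[of k] by simp
qed

end
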